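(* Let $q$ be a power of $2$. Then the power graph of $\mathrm{PSL}(3,q)$ is a chordal graph if $q=2$ or $q=4$.
   Context: The power graph $\mathcal{P}(G)$ of a group $G$ is the undirected simple graph with vertex set $G$ in which distinct $a,b$ are adjacent iff $a=b^m$ or $b=a^n$ for some positive integers $m,n$. A graph is chordal if it has no induced cycle of length $4$ or more. *)

theory Defs
  imports "HOL-Analysis.Determinants" "HOL-Algebra.Coset"
begin

text \<open>
  A simple graph is a pair consisting of its vertex set and its edge set, where an edge is a
  two-element set of vertices.
\<close>

type_synonym 'v sgraph = "'v set \<times> 'v set set"

definition cycle_edges :: "'v list \<Rightarrow> 'v set set" where
  "cycle_edges vs = {{vs ! i, vs ! (Suc i mod length vs)} | i. i < length vs}"

definition is_cycle :: "'v sgraph \<Rightarrow> 'v list \<Rightarrow> bool" where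
  "is_cycle \<Gamma> vs \<longleftrightarrow>
     3 \<le> length vs \<and> distinct vs \<and> set vs \<subseteq> fst \<Gamma> \<and> cycle_edges vs \<subseteq> snd \<Gamma>"

definition is_induced_cycle :: "'v sgraph \<Rightarrow> 'v list \<Rightarrow> bool" where
  "is_induced_cycle \<Gamma> vs \<longleftrightarrow>
     is_cycle \<Gamma> vs \<and> {e \<in> snd \<Gamma>. e \<subseteq> set vs} = cycle_edges vs"

definition chordal :: "'v sgraph \<Rightarrow> bool" where
  "chordal \<Gamma> \<longleftrightarrow> \<not> (\<exists>vs. is_induced_cycle \<Gamma> vs \<and> 4 \<le> length vs)"

definition power_graph :: "('a, 'b) monoid_scheme \<Rightarrow> 'a sgraph" where
  "power_graph G =
     (carrier G,
      {{a, b} | a b. a \<in> carrier G \<and> b \<in> carrier G \<and> a \<noteq> b \<and>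
         ((\<exists>m::nat. 0 < m \<and> a = b [^]\<^bsub>G\<^esub> m) \<or> (\<exists>n::nat. 0 < n \<and> b = a [^]\<^bsub>G\<^esub> n))})"

definition group_center :: "('a, 'b) monoid_scheme \<Rightarrow> 'a set" where
  "group_center G = {z \<in> carrier G. \<forall>x \<in> carrier G. z \<otimes>\<^bsub>G\<^esub> x = x \<otimes>\<^bsub>G\<^esub> z}"

text \<open>
  The degree and the field are given by types: for a finite field \<open>'a\<close> of order \<open>q\<close> and an index
  type \<open>'n\<close> with \<open>n\<close> elements, \<open>SL\<close> and \<open>PSL\<close> below are SL(n,q) and
  PSL(n,q) = SL(n,q) / Z(SL(n,q)).
\<close>

definition SL :: "('a::field ^ 'n ^ 'n) monoid" where
  "SL = \<lparr>carrier = {A. det A = 1}, mult = (**), one = mat 1\<rparr>"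

definition PSL :: "('a::field ^ 'n ^ 'n) set monoid" where
  "PSL = SL Mod (group_center SL)"

lemma group_SL: "group (SL :: ('a::field ^ 'n ^ 'n) monoid)"
proof (rule groupI)
  fix A :: "'a ^ 'n ^ 'n"
  assume "A \<in> carrier SL"
  then have "det A = 1" by (simp add: SL_def)
  then obtain B where B: "A ** B = mat 1" "B ** A = mat 1"
    by (metis invertible_def invertible_det_nz zero_neq_one)
  then have "det B = 1"
    by (metis \<open>det A = 1\<close> det_I det_mul mult_1)
  with B show "\<exists>B \<in> carrier SL. B \<otimes>\<^bsub>SL\<^esub> A = \<one>\<^bsub>SL\<^esub>"
    by (auto simp: SL_def)
qed (auto simp: SL_def det_mul matrix_mul_assoc)

lemma (in group) normal_group_center: "group_center G \<lhd> G"
proof -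
  have inv_cl: "inv z \<otimes> x = x \<otimes> inv z"
    if "z \<in> carrier G" "x \<in> carrier G" "z \<otimes> x = x \<otimes> z" for z x
  proof -
    have "x = z \<otimes> (x \<otimes> inv z)"
      using that by (simp add: m_assoc[symmetric]) (simp add: m_assoc)
    then show ?thesis
      using that by (simp add: inv_solve_left')
  qed
  have mult_cl: "a \<otimes> b \<otimes> x = x \<otimes> (a \<otimes> b)"
    if "a \<in> carrier G" "b \<in> carrier G" "x \<in> carrier G" "a \<otimes> x = x \<otimes> a" "b \<otimes> x = x \<otimes> b" for a b x
  proof -
    have "a \<otimes> b \<otimes> x = a \<otimes> x \<otimes> b"
      unfolding m_assoc[OF that(1-3)] that(5) using that(1-3) by (simp add: m_assoc)
    also have "\<dots> = x \<otimes> a \<otimes> b" using that by simp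
    also have "\<dots> = x \<otimes> (a \<otimes> b)" using that(1-3) by (simp add: m_assoc)
    finally show ?thesis .
  qed
  have sub: "subgroup (group_center G) G"
  proof (rule subgroupI)
    show "group_center G \<noteq> {}"
      using r_one l_one one_closed by (force simp: group_center_def)
  next
    show "inv a \<in> group_center G" if "a \<in> group_center G" for a
      using that inv_cl inv_closed unfolding group_center_def by blast
  next
    show "a \<otimes> b \<in> group_center G" if "a \<in> group_center G" "b \<in> group_center G" for a b
      using that mult_cl m_closed unfolding group_center_def by blast
  next
    show "group_center G \<subseteq> carrier G" unfolding group_center_def by blast
  qed
  have "x \<otimes> h \<otimes> inv x \<in> group_center G" if "x \<in> carrier G" "h \<in> group_center G" for x h
  proof -
    have h: "h \<in> carrier G" "x \<otimes> h = h \<otimes> x"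
      using that by (auto simp: group_center_def)
    have "x \<otimes> h \<otimes> inv x = h"
      unfolding h(2) using that(1) h(1) by (simp add: m_assoc)
    with that(2) show ?thesis by simp
  qed
  with sub show ?thesis
    by (simp add: normal_inv_iff)
qed

lemma group_PSL: "group (PSL :: ('a::field ^ 'n ^ 'n) set monoid)"
  unfolding PSL_def
  by (rule normal.factorgroup_is_group[OF group.normal_group_center[OF group_SL]])

end

theory Submission
  imports Defs "HOL-Computational_Algebra.Primes"
begin

text \<open>
  In a cyclic group of prime power order the subgroups form a chain. Hence, if every element
  of a group \<open>G\<close> has prime power order, of any two powers of a common element one is a power of
  the other. This makes the power graph chordal: on an induced cycle of length at least four choose
  a vertex \<open>v\<close> that is maximal for the preorder ``is a power of''. By maximality both neighbours of
  \<open>v\<close> on the cycle are powers of \<open>v\<close>, so they are adjacent, which is a chord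
  (lemma \<open>chordal_power_graph_prime_power_orders\<close>).

  It remains to see that for \<open>q = 2\<close> and \<open>q = 4\<close> every element of PSL(3,q) has prime power order.
  Both fields satisfy \<open>x^4 = x\<close>, which at \<open>x = -1\<close> shows that they have characteristic 2. Let \<open>A\<close> have determinant 1, trace \<open>t\<close> and sum of principal
  2-minors \<open>s\<close>. By the Cayley-Hamilton identity \<open>A^3 = t A^2 + s A + 1\<close>, so every power of \<open>A\<close> is a
  quadratic polynomial in \<open>A\<close> whose coefficients are polynomials in \<open>t\<close> and \<open>s\<close>. Reducing them
  with \<open>x^4 = x\<close> shows that one of \<open>A^3\<close>, \<open>A^4\<close>, \<open>A^5\<close>, \<open>A^7\<close> is scalar
  (lemma \<open>scalar_prime_power\<close>), and scalar matrices become trivial in PSL(3,q).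

  The four exponents reflect how the characteristic polynomial factors over the field with four
  elements. Three different roots there give \<open>A^3 = 1\<close>. A repeated root must be triple, because
  \<open>a^2 b = 1\<close> and \<open>a^3 = 1\<close> force \<open>b = a\<close>; then \<open>A^4\<close> is scalar. With an
  irreducible quadratic factor \<open>A^5\<close> is scalar, and with an irreducible cubic \<open>A^7\<close> is.
\<close>

section \<open>Power graphs of groups with elements of prime power order\<close>

definition is_power_of :: "('a, 'b) monoid_scheme \<Rightarrow> 'a \<Rightarrow> 'a \<Rightarrow> bool" where
  "is_power_of G a b \<longleftrightarrow> (\<exists>m::nat. 0 < m \<and> a = b [^]\<^bsub>G\<^esub> m)"

lemma (in monoid) is_power_of_refl: "a \<in> carrier G \<Longrightarrow> is_power_of G a a"
  unfolding is_power_of_def by (rule exI[of _ 1]) simp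

lemma (in monoid) is_power_of_trans:
  "c \<in> carrier G \<Longrightarrow> is_power_of G a b \<Longrightarrow> is_power_of G b c \<Longrightarrow> is_power_of G a c"
  unfolding is_power_of_def by (metis nat_0_less_mult_iff nat_pow_pow)

lemma power_graph_edge_iff:
  "{a, b} \<in> snd (power_graph G) \<longleftrightarrow>
     a \<in> carrier G \<and> b \<in> carrier G \<and> a \<noteq> b \<and> (is_power_of G a b \<or> is_power_of G b a)"
  unfolding power_graph_def is_power_of_def by (auto simp: doubleton_eq_iff)

text \<open>
  This is Bezout's theorem: when \<open>gcd i N\<close> divides \<open>j\<close>, the congruence
  \<open>i z = j\<close> modulo \<open>N\<close> has a solution \<open>z\<close>.
\<close>

lemma (in monoid) is_power_of_of_gcd_dvd:
  assumes c: "c \<in> carrier G" "c [^] (N::nat) = \<one>"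
    and pos: "0 < i" "0 < j" and dvd: "gcd i N dvd j"
  shows "is_power_of G (c [^] j) (c [^] i)"
proof -
  obtain x y where xy: "i * x = N * y + gcd i N"
    using bezout_nat[of i N] pos by auto
  have "0 < x"
    using xy pos by (cases x) auto
  obtain l where l: "j = gcd i N * l"
    using dvd by blast
  have "0 < l"
    using l pos by (cases l) auto
  have "i * (x * l) = N * (y * l) + j"
    using xy l by (metis add_mult_distrib mult.assoc)
  then have "(c [^] i) [^] (x * l) = (c [^] N) [^] (y * l) \<otimes> c [^] j"
    using c(1) by (simp only: nat_pow_pow nat_pow_mult)
  also have "\<dots> = c [^] j"
    using c by simp
  finally show ?thesis
    using \<open>0 < x\<close> \<open>0 < l\<close> unfolding is_power_of_def by (metis nat_0_less_mult_iff)
qed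

text \<open>
  The divisors of \<open>p^k\<close> form a chain, so of the two greatest common divisors with
  \<open>p^k\<close> one divides the other.
\<close>

lemma (in monoid) is_power_of_linear:
  assumes c: "c \<in> carrier G" "c [^] (p ^ k :: nat) = \<one>" and p: "prime (p::nat)"
    and a: "is_power_of G a c" and b: "is_power_of G b c"
  shows "is_power_of G a b \<or> is_power_of G b a"
proof -
  obtain i j :: nat where ij: "0 < i" "a = c [^] i" "0 < j" "b = c [^] j"
    using a b unfolding is_power_of_def by auto
  obtain e where e: "gcd i (p ^ k) = p ^ e"
    using divides_primepow_nat[OF p] gcd_dvd2 by blast
  obtain f where f: "gcd j (p ^ k) = p ^ f"
    using divides_primepow_nat[OF p] gcd_dvd2 by blast
  consider "e \<le> f" | "f \<le> e" by linarith
  then show ?thesis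
  proof cases
    case 1
    then have "gcd i (p ^ k) dvd j"
      using e f by (metis dvd_trans gcd_dvd1 le_imp_power_dvd)
    then show ?thesis
      using is_power_of_of_gcd_dvd[OF c] ij by blast
  next
    case 2
    then have "gcd j (p ^ k) dvd i"
      using e f by (metis dvd_trans gcd_dvd1 le_imp_power_dvd)
    then show ?thesis
      using is_power_of_of_gcd_dvd[OF c] ij by blast
  qed
qed

text \<open>
  Counting the elements below a point turns the preorder into an order on natural numbers, where a
  maximum exists; equality of the counts then gives equality of the lower sets.
\<close>

lemma finite_preorder_has_maximal:
  assumes "finite S" "S \<noteq> {}"
    and refl: "\<And>x. x \<in> S \<Longrightarrow> R x x"
    and trans: "\<And>x y z. x \<in> S \<Longrightarrow> y \<in> S \<Longrightarrow> z \<in> S \<Longrightarrow> R x y \<Longrightarrow> R y z \<Longrightarrow> R x z"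
  obtains v where "v \<in> S" "\<And>u. u \<in> S \<Longrightarrow> R v u \<Longrightarrow> R u v"
proof -
  define h where "h v = card {x \<in> S. R x v}" for v
  have "Max (h ` S) \<in> h ` S"
    using assms by (intro Max_in) auto
  then obtain v where v: "v \<in> S" "h v = Max (h ` S)" by auto
  have "R u v" if u: "u \<in> S" "R v u" for u
  proof -
    have "h u \<le> h v"
      using v u \<open>finite S\<close> by simp
    moreover have "{x \<in> S. R x v} \<subseteq> {x \<in> S. R x u}"
      using trans u v by blast
    ultimately have "{x \<in> S. R x v} = {x \<in> S. R x u}"
      using \<open>finite S\<close> unfolding h_def by (intro card_seteq) auto
    then show ?thesis
      using refl u by blast
  qed
  with v show thesis by (intro that)
qed

text \<open>
  On an induced cycle of length at least four the two neighbours of a vertex are not joined: an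
  edge between them would be one of the cycle's own edges, and those join consecutive vertices.
\<close>

lemma induced_cycle_neighbours:
  assumes cyc: "is_induced_cycle \<Gamma> vs" and len: "4 \<le> length vs" and v: "v \<in> set vs"
  obtains u w where "u \<in> set vs" "w \<in> set vs" "u \<noteq> w"
    "{u, v} \<in> snd \<Gamma>" "{w, v} \<in> snd \<Gamma>" "{u, w} \<notin> snd \<Gamma>"
proof -
  define n where "n = length vs"
  have n: "4 \<le> n" "distinct vs" and edges: "cycle_edges vs \<subseteq> snd \<Gamma>"
    and induced: "{e \<in> snd \<Gamma>. e \<subseteq> set vs} = cycle_edges vs"
    using cyc len unfolding is_induced_cycle_def is_cycle_def n_def by auto
  have nxt: "Suc j mod n = (if Suc j = n then 0 else Suc j)" if "j < n" for j
    using that by simp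
  obtain i where i: "i < n" "vs ! i = v"
    using v unfolding n_def by (auto simp: in_set_conv_nth)
  define a where "a = (if Suc i = n then 0 else Suc i)"
  define b where "b = (if i = 0 then n - 1 else i - 1)"
  have ab: "a < n" "b < n" "a \<noteq> b"
    using i n unfolding a_def b_def by (auto split: if_splits)
  have edge: "{vs ! j, vs ! (if Suc j = n then 0 else Suc j)} \<in> cycle_edges vs" if "j < n" for j
    unfolding cycle_edges_def using that nxt[OF that] n_def by force
  have edge_a: "{vs ! a, v} \<in> cycle_edges vs"
    using edge[OF i(1)] i unfolding a_def by (simp add: insert_commute)
  have "(if Suc b = n then 0 else Suc b) = i"
    using i n unfolding b_def by auto
  then have edge_b: "{vs ! b, v} \<in> cycle_edges vs"
    using edge[OF ab(2)] i by simp
  have "{vs ! a, vs ! b} \<notin> cycle_edges vs"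
  proof
    assume "{vs ! a, vs ! b} \<in> cycle_edges vs"
    then obtain j where j: "j < n" "{vs ! a, vs ! b} = {vs ! j, vs ! (Suc j mod n)}"
      unfolding cycle_edges_def n_def by blast
    define j' where "j' = (if Suc j = n then 0 else Suc j)"
    have "j' < n" using j n unfolding j'_def by auto
    have "{vs ! a, vs ! b} = {vs ! j, vs ! j'}"
      using j nxt unfolding j'_def by simp
    then have "a = j \<and> b = j' \<or> a = j' \<and> b = j"
      using ab j(1) \<open>j' < n\<close> n(2) unfolding doubleton_eq_iff n_def
      by (simp add: nth_eq_iff_index_eq)
    then show False
      using i n(1) j(1) unfolding a_def b_def j'_def by (auto split: if_splits)
  qed
  then have "{vs ! a, vs ! b} \<notin> snd \<Gamma>"
    using induced ab unfolding n_def by auto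
  moreover have "vs ! a \<noteq> vs ! b"
    using ab n(2) unfolding n_def by (simp add: nth_eq_iff_index_eq)
  ultimately show thesis
    using that[of "vs ! a" "vs ! b"] edge_a edge_b edges ab unfolding n_def by auto
qed

text \<open>
  The chord of a long cycle joins the two neighbours of a vertex that is maximal for
  \<open>is_power_of\<close>.
\<close>

theorem (in group) chordal_power_graph_prime_power_orders:
  assumes pp: "\<And>x. x \<in> carrier G \<Longrightarrow> \<exists>p k. prime (p::nat) \<and> x [^] (p ^ k :: nat) = \<one>"
  shows "chordal (power_graph G)"
  unfolding chordal_def
proof
  assume "\<exists>vs. is_induced_cycle (power_graph G) vs \<and> 4 \<le> length vs"
  then obtain vs where vs: "is_induced_cycle (power_graph G) vs" "4 \<le> length vs" by blast
  have sub: "set vs \<subseteq> carrier G"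
    using vs(1) unfolding is_induced_cycle_def is_cycle_def power_graph_def by simp
  obtain v where v: "v \<in> set vs"
    and max: "\<And>u. u \<in> set vs \<Longrightarrow> is_power_of G v u \<Longrightarrow> is_power_of G u v"
  proof (rule finite_preorder_has_maximal[of "set vs" "is_power_of G"])
    show "set vs \<noteq> {}" using vs(2) by auto
    show "is_power_of G x x" if "x \<in> set vs" for x
      using that sub is_power_of_refl by blast
    show "is_power_of G x z"
      if "z \<in> set vs" "is_power_of G x y" "is_power_of G y z" for x y z
      using that sub is_power_of_trans by blast
  qed auto
  obtain u w where uw: "u \<in> set vs" "w \<in> set vs" "u \<noteq> w"
    and edges: "{u, v} \<in> snd (power_graph G)" "{w, v} \<in> snd (power_graph G)"
    and nonedge: "{u, w} \<notin> snd (power_graph G)"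
    using induced_cycle_neighbours[OF vs v] by blast
  have "is_power_of G u v" "is_power_of G w v"
    using edges max uw unfolding power_graph_edge_iff by blast+
  moreover obtain p k where "prime (p::nat)" "v [^] (p ^ k :: nat) = \<one>"
    using pp v sub by blast
  ultimately have "is_power_of G u w \<or> is_power_of G w u"
    using is_power_of_linear v sub by blast
  then show False
    using nonedge uw sub unfolding power_graph_edge_iff by blast
qed

section \<open>Powers of a 3 by 3 matrix\<close>

definition principal_minor_sum :: "'a::comm_ring_1 ^ 3 ^ 3 \<Rightarrow> 'a" where
  "principal_minor_sum A =
     (A$1$1 * A$2$2 - A$1$2 * A$2$1) + (A$1$1 * A$3$3 - A$1$3 * A$3$1) +
     (A$2$2 * A$3$3 - A$2$3 * A$3$2)"

definition quadratic_in :: "'a::comm_ring_1 ^ 'n ^ 'n \<Rightarrow> 'a \<Rightarrow> 'a \<Rightarrow> 'a \<Rightarrow> 'a ^ 'n ^ 'n" where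
  "quadratic_in A x y z = (\<chi> i j. x * (A ** A)$i$j + y * A$i$j + z * mat 1$i$j)"

lemma cayley_hamilton_3:
  fixes A :: "'a::comm_ring_1 ^ 3 ^ 3"
  shows "A ** A ** A = quadratic_in A (trace A) (- principal_minor_sum A) (det A)"
  unfolding vec_eq_iff forall_3
  by (simp add: quadratic_in_def principal_minor_sum_def trace_def det_3 sum_3
      matrix_matrix_mult_def mat_def algebra_simps)

lemma quadratic_in_mult:
  fixes A :: "'a::comm_ring_1 ^ 3 ^ 3"
  shows "quadratic_in A x y z ** A =
    quadratic_in A (x * trace A + y) (z - x * principal_minor_sum A) (x * det A)"
proof -
  have "(quadratic_in A x y z ** A)$i$j =
      x * (A ** A ** A)$i$j + y * (A ** A)$i$j + z * (mat 1 ** A)$i$j" for i j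
    unfolding matrix_matrix_mult_def[of "quadratic_in A x y z"] matrix_matrix_mult_def[of "A ** A"]
      matrix_matrix_mult_def[of A A] matrix_matrix_mult_def[of "mat 1"]
    by (simp add: quadratic_in_def matrix_matrix_mult_def sum_distrib_left sum.distrib algebra_simps)
  then show ?thesis
    unfolding vec_eq_iff cayley_hamilton_3
    by (simp add: quadratic_in_def algebra_simps)
qed

lemma quadratic_in_scalar: "quadratic_in A 0 0 z = mat z"
  by (simp add: quadratic_in_def mat_def vec_eq_iff)

lemma scalar_commute: "mat c ** A = A ** mat (c :: 'a::comm_ring_1)"
  by (simp add: matrix_matrix_mult_def mat_def vec_eq_iff if_distrib if_distribR mult.commute cong: if_cong)

section \<open>Elements of PSL(3,2) and PSL(3,4)\<close>

text \<open>
  Multiplication by \<open>x \<noteq> 0\<close> permutes the nonzero elements; comparing the products of all of them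
  before and after gives \<open>x^(q-1) = 1\<close>.
\<close>

lemma finite_field_power_card:
  fixes x :: "'a::{field, finite}"
  shows "x ^ CARD('a) = x"
proof (cases "x = 0")
  case False
  define U where "U = (UNIV - {0} :: 'a set)"
  have "bij_betw ((*) x) U U"
    using False unfolding U_def
    by (intro bij_betw_byWitness[where f' = "\<lambda>y. y / x"]) auto
  then have "(\<Prod>y\<in>U. x * y) = \<Prod>U"
    by (rule prod.reindex_bij_betw)
  then have "x ^ card U * \<Prod>U = 1 * \<Prod>U"
    by (simp add: prod.distrib)
  moreover have "\<Prod>U \<noteq> 0"
    by (simp add: U_def)
  ultimately have "x ^ card U = 1"
    by simp
  moreover have "CARD('a) = Suc (card U)"
    unfolding U_def using card_Suc_Diff1[of UNIV "0::'a"] by simp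
  ultimately show ?thesis by simp
qed simp

lemma nat_pow_SL_Suc: "A [^]\<^bsub>SL\<^esub> Suc n = A [^]\<^bsub>SL\<^esub> n ** A"
  by (simp add: SL_def)

text \<open>
  Write \<open>t\<close> for the trace and \<open>s\<close> for the sum of the principal minors. If both vanish,
  \<open>A^3\<close> is scalar; if exactly one does, \<open>A^7\<close> is. Otherwise \<open>t^3 = s^3 = 1\<close>, so
  \<open>(s t)^3 = 1\<close>: either \<open>s t = 1\<close> and \<open>A^4\<close> is scalar, or \<open>(s t)^2 + s t + 1 = 0\<close> and
  \<open>A^5\<close> is.
\<close>

lemma scalar_prime_power:
  fixes A :: "'a::field ^ 3 ^ 3"
  assumes fld: "\<And>x::'a. x ^ 4 = x" and A: "A \<in> carrier SL"
  shows "\<exists>p k c. prime (p::nat) \<and> A [^]\<^bsub>SL\<^esub> (p ^ k :: nat) = mat c"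
proof -
  define t where "t = trace A"
  define s where "s = principal_minor_sum A"
  \<comment> \<open>At \<open>x = -1\<close> the equation \<open>x^4 = x\<close> says \<open>1 = -1\<close>.\<close>
  have two: "(1::'a) + 1 = 0"
    using fld[of "-1"] by (simp add: eq_neg_iff_add_eq_0)
  have neg: "- x = x" for x :: 'a
    using two by (metis add_eq_0_iff2 distrib_right mult_1 mult_zero_left)
  have dbl: "x + x = 0" for x :: 'a
    using neg[of x] by (metis add.left_inverse)
  have cube: "x ^ 3 = 1" if "x \<noteq> 0" for x :: 'a
    using fld[of x] that by (simp add: eval_nat_numeral)
  have det: "det A = 1"
    using A by (simp add: SL_def)
  have step: "A [^]\<^bsub>SL\<^esub> Suc n = quadratic_in A (x * t + y) (x * s + z) x"
    if "A [^]\<^bsub>SL\<^esub> n = quadratic_in A x y z" for n x y z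
  proof -
    have "z - x * s = x * s + z"
      using neg[of "x * s"] by (metis add.commute diff_conv_add_uminus)
    then show ?thesis
      unfolding nat_pow_SL_Suc that quadratic_in_mult det t_def[symmetric] s_def[symmetric]
      by (simp only: mult_1_right)
  qed
  have "A [^]\<^bsub>SL\<^esub> (0::nat) = quadratic_in A 0 0 1"
    by (simp add: SL_def quadratic_in_scalar)
  then have p3: "A [^]\<^bsub>SL\<^esub> (3::nat) = quadratic_in A t s 1"
    using step[OF step[OF step]] by (fastforce simp: numeral_3_eq_3)
  have p4: "A [^]\<^bsub>SL\<^esub> (4::nat) = quadratic_in A (t * t + s) (t * s + 1) t"
    using step[OF p3] by simp
  obtain x y z where p5: "A [^]\<^bsub>SL\<^esub> (5::nat) = quadratic_in A x y z"
    and xyz: "x = (t * t + s) * t + (t * s + 1)" "y = (t * t + s) * s + t" "z = t * t + s"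
    using step[OF p4] by simp
  have p7: "A [^]\<^bsub>SL\<^esub> (7::nat) =
      quadratic_in A ((x * t + y) * t + (x * s + z)) ((x * t + y) * s + x) (x * t + y)"
    using step[OF step[OF p5]] by simp
  have prime3: "prime (3::nat)" and prime5: "prime (5::nat)" and prime7: "prime (7::nat)"
    by simp_all
  consider "t = 0" "s = 0" | "t = 0" "s \<noteq> 0" | "t \<noteq> 0" "s = 0" | "t \<noteq> 0" "s \<noteq> 0" by blast
  then show ?thesis
  proof cases
    case 1
    then have "A [^]\<^bsub>SL\<^esub> (3 ^ 1 :: nat) = mat 1"
      using p3 by (simp add: quadratic_in_scalar)
    then show ?thesis
      using prime3 by blast
  next
    case 2
    have "s * s * s = 1"
      using cube[OF 2(2)] by (simp add: power3_eq_cube)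
    then have "A [^]\<^bsub>SL\<^esub> (7 ^ 1 :: nat) = mat (x * t + y)"
      using p7 2(1) xyz by (simp add: quadratic_in_scalar two dbl)
    then show ?thesis
      using prime7 by blast
  next
    case 3
    have "t * t * t = 1"
      using cube[OF 3(1)] by (simp add: power3_eq_cube)
    then have "A [^]\<^bsub>SL\<^esub> (7 ^ 1 :: nat) = mat (x * t + y)"
      using p7 3(2) xyz by (simp add: quadratic_in_scalar two dbl)
    then show ?thesis
      using prime7 by blast
  next
    case 4
    have t3: "t * t * t = 1" and u3: "(s * t) ^ 3 = 1"
      using cube[OF 4(1)] cube[of "s * t"] 4 by (simp_all add: power3_eq_cube)
    show ?thesis
    proof (cases "s * t = 1")
      case True
      \<comment> \<open>Then \<open>s\<close> is the inverse of \<open>t\<close>, which is \<open>t^2\<close>, and the coefficient \<open>t^2 + s\<close> vanishes.\<close>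
      have "s = s * t * (t * t)"
        using t3 by (simp add: mult.assoc)
      then have "s = t * t"
        using True by simp
      then have "A [^]\<^bsub>SL\<^esub> (2 ^ 2 :: nat) = mat t"
        using p4 t3 by (simp add: quadratic_in_scalar two dbl mult.assoc)
      then show ?thesis
        using two_is_prime_nat by blast
    next
      case False
      have "(s * t - 1) * ((s * t) * (s * t) + s * t + 1) = (s * t) ^ 3 - 1"
        by (simp add: power3_eq_cube algebra_simps)
      then have u: "(s * t) * (s * t) + s * t + 1 = 0"
        using u3 False by simp
      \<comment> \<open>Multiplying by \<open>t^2\<close> and using \<open>t^3 = 1\<close> makes \<open>y\<close> a polynomial in \<open>s t\<close>.\<close>
      have "t * t * y = (s * t) * (s * t) + (t * t * t) * (s * t) + t * t * t"
        unfolding xyz by (simp add: algebra_simps)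
      then have "y = 0"
        using u 4(1) t3 by simp
      moreover have "x = t * t * t + 1 + (s * t + s * t)"
        unfolding xyz by (simp add: algebra_simps)
      then have "x = 0"
        using t3 by (simp add: two dbl)
      ultimately have "A [^]\<^bsub>SL\<^esub> (5 ^ 1 :: nat) = mat z"
        using p5 by (simp add: quadratic_in_scalar)
      then show ?thesis
        using prime5 by blast
    qed
  qed
qed

lemma scalar_in_center:
  "mat c \<in> carrier (SL :: ('a::field ^ 'n ^ 'n) monoid) \<Longrightarrow>
    mat c \<in> group_center (SL :: ('a ^ 'n ^ 'n) monoid)"
  by (simp add: group_center_def SL_def scalar_commute)

lemma PSL_prime_power_order:
  assumes fld: "\<And>x::'a::field. x ^ 4 = x" and X: "X \<in> carrier (PSL :: ('a ^ 3 ^ 3) set monoid)"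
  shows "\<exists>p k. prime (p::nat) \<and> X [^]\<^bsub>PSL\<^esub> (p ^ k :: nat) = \<one>\<^bsub>PSL\<^esub>"
proof -
  let ?S = "SL :: ('a ^ 3 ^ 3) monoid"
  let ?Z = "group_center ?S"
  interpret S: group ?S by (rule group_SL)
  interpret Z: normal ?Z ?S by (rule S.normal_group_center)
  interpret hom: group_hom ?S PSL "\<lambda>A. ?Z #>\<^bsub>?S\<^esub> A"
    using Z.r_coset_hom_Mod group_PSL unfolding PSL_def
    by (simp add: group_hom_def group_hom_axioms_def S.group_axioms)
  obtain A where A: "A \<in> carrier ?S" "X = ?Z #>\<^bsub>?S\<^esub> A"
    using X unfolding PSL_def FactGroup_def RCOSETS_def by auto
  obtain p k c where p: "prime (p::nat)" and pw: "A [^]\<^bsub>?S\<^esub> (p ^ k :: nat) = mat c"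
    using scalar_prime_power[OF fld A(1)] by blast
  have "mat c \<in> carrier ?S"
    using S.nat_pow_closed[OF A(1)] pw by metis
  then have "?Z #>\<^bsub>?S\<^esub> mat c = ?Z"
    using S.coset_join2[OF _ Z.is_subgroup] scalar_in_center by blast
  then have "X [^]\<^bsub>PSL\<^esub> (p ^ k :: nat) = \<one>\<^bsub>PSL\<^esub>"
    using hom.hom_nat_pow[OF A(1), of "p ^ k"] pw A(2) by (simp add: PSL_def FactGroup_def)
  with p show ?thesis by blast
qed

theorem theorem5p7:
  fixes q :: nat
  assumes "CARD('a::{field, finite}) = q"
    and "\<exists>k::nat. 1 \<le> k \<and> q = 2 ^ k"
    and "q = 2 \<or> q = 4"
  shows "chordal (power_graph (PSL :: ('a ^ 3 ^ 3) set monoid))"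
proof -
  have fld: "x ^ 4 = x" for x :: 'a
  proof -
    have "x ^ 2 = x \<or> x ^ 4 = x"
      using finite_field_power_card[of x] assms(1,3) by auto
    moreover have "x ^ 4 = (x ^ 2) ^ 2"
      by (simp flip: power_mult)
    ultimately show ?thesis by metis
  qed
  show ?thesis
    by (rule group.chordal_power_graph_prime_power_orders[OF group_PSL PSL_prime_power_order[OF fld]])
qed

end
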